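(* Suppose Alice and Bob perform identical experiments with outcomes $v_1<\dots<v_n$ (real numbers), where the outcome $v_i$ has probability $q_i$. Alice performs her experiment first and obtains a result $X$. She then uses a pointer $p$, a random real number drawn from a distribution that is non-zero on open sets (it gives positive probability to every nonempty open subset of $\mathbb{R}$). Alice guesses that her result is greater than Bob's result $Y$ if $p<X$, and that Bob's result is greater than hers if $p>X$. Assume that if Alice and Bob have the same result, the probability that Alice guesses successfully is $\tfrac12$. Then the probability $P(SG)$ that Alice guesses successfully is greater than $\tfrac12$.
   Context: $X$ and $Y$ are the results of single trials of the same experiment, performed separately by Alice and by Bob; $X$, $Y$ and the pointer $p$ are independent. Alice sees only $X$ and $p$ when she makes her guess. $P(SG)$ denotes the probability of a successful guess.
   Formalization: The formal theorem additionally assumes that at least two of the outcomes have positive probability; if a single outcome has probability 1 (for example n = 1), Alice and Bob always tie and P(SG) is exactly 1/2. *)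

theory Defs
  imports "HOL-Probability.Probability"
begin

end

theory Submission
  imports Defs
begin

text \<open>Condition on the pair \<open>(X, Y) = (v i, v j)\<close> with \<open>v i < v j\<close>, or its mirror image, which is
  equally likely. In the first case Alice succeeds when \<open>p > v i\<close>, in the second when \<open>p < v j\<close>.
  These two events for \<open>p\<close> cover the line and overlap in the interval \<open>(v i, v j)\<close>, which has
  positive probability, so their probabilities add up to more than 1. This holds whatever happens
  on \<open>p = X\<close>, so atoms of \<open>p\<close> do no harm.\<close>

text \<open>Independence is stated for a family indexed by numbers, with the variables packed in a
  list. This lemma unpacks it into the product rule for events about the triple of
  variables.\<close>

lemma (in prob_space) indep_vars_three:
  assumes "indep_vars (\<lambda>_. N) (\<lambda>i. [X, Y, Z] ! i) {..<3}"
    and "A \<in> sets N" "B \<in> sets N" "C \<in> sets N"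
  shows "\<P>(\<omega> in M. X \<omega> \<in> A \<and> Y \<omega> \<in> B \<and> Z \<omega> \<in> C)
    = \<P>(\<omega> in M. X \<omega> \<in> A) * \<P>(\<omega> in M. Y \<omega> \<in> B) * \<P>(\<omega> in M. Z \<omega> \<in> C)"
proof -
  have I: "{..<3::nat} = {0, 1, 2}" by auto
  have "prob (\<Inter>i\<in>{..<3}. ([X, Y, Z] ! i) -` ([A, B, C] ! i) \<inter> space M)
      = (\<Prod>i\<in>{..<3}. prob (([X, Y, Z] ! i) -` ([A, B, C] ! i) \<inter> space M))"
    by (rule indep_varsD[OF assms(1)]) (use assms(2-4) in \<open>auto simp: I\<close>)
  moreover have "(\<Inter>i\<in>{..<3}. ([X, Y, Z] ! i) -` ([A, B, C] ! i) \<inter> space M)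
      = {\<omega> \<in> space M. X \<omega> \<in> A \<and> Y \<omega> \<in> B \<and> Z \<omega> \<in> C}"
    by (auto simp: I)
  ultimately show ?thesis
    by (simp add: I vimage_def Int_def conj_commute mult.assoc)
qed

text \<open>Swapping the two indices leaves the weight \<open>q i * q j\<close> unchanged, so twice
  the sum has \<open>h i j + h j i\<close> in place of \<open>h i j\<close>. Termwise this is at
  least the weight, and the weights add up to the square of 1.\<close>

lemma double_sum_symmetrization_gt:
  fixes q :: "'i \<Rightarrow> real"
  assumes "finite I" and "\<And>i. i \<in> I \<Longrightarrow> q i \<ge> 0" and "(\<Sum>i\<in>I. q i) = 1"
    and "\<And>i j. i \<in> I \<Longrightarrow> j \<in> I \<Longrightarrow> h i j + h j i \<ge> 1"
    and "a \<in> I" "b \<in> I" "q a > 0" "q b > 0" "h a b + h b a > 1"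
  shows "(\<Sum>i\<in>I. \<Sum>j\<in>I. q i * q j * h i j) > 1 / 2"
proof -
  let ?S = "\<Sum>i\<in>I. \<Sum>j\<in>I. q i * q j * h i j"
  have "?S = (\<Sum>i\<in>I. \<Sum>j\<in>I. q i * q j * h j i)"
    by (subst sum.swap) (simp add: mult.commute)
  then have "2 * ?S = (\<Sum>i\<in>I. \<Sum>j\<in>I. q i * q j * (h i j + h j i))"
    by (simp add: distrib_left sum.distrib)
  also have "\<dots> > (\<Sum>i\<in>I. \<Sum>j\<in>I. q i * q j)"
  proof (rule sum_strict_mono_ex1[OF assms(1)])
    have le: "q i * q j \<le> q i * q j * (h i j + h j i)" if "i \<in> I" "j \<in> I" for i j
      using mult_left_mono[of 1 "h i j + h j i" "q i * q j"] assms that by simp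
    then show "\<forall>i\<in>I. (\<Sum>j\<in>I. q i * q j) \<le> (\<Sum>j\<in>I. q i * q j * (h i j + h j i))"
      by (auto intro: sum_mono)
    \<comment> \<open>The entry \<open>(a, b)\<close> makes row \<open>a\<close> strict, and row
      \<open>a\<close> makes the double sum strict.\<close>
    have "(\<Sum>j\<in>I. q a * q j) < (\<Sum>j\<in>I. q a * q j * (h a j + h j a))"
    proof (rule sum_strict_mono_ex1[OF assms(1)])
      show "\<forall>j\<in>I. q a * q j \<le> q a * q j * (h a j + h j a)"
        using le \<open>a \<in> I\<close> by blast
      have "q a * q b < q a * q b * (h a b + h b a)"
        using mult_strict_left_mono[of 1 "h a b + h b a" "q a * q b"] assms(7-9) by simp
      then show "\<exists>j\<in>I. q a * q j < q a * q j * (h a j + h j a)"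
        using \<open>b \<in> I\<close> by blast
    qed
    then show "\<exists>i\<in>I. (\<Sum>j\<in>I. q i * q j) < (\<Sum>j\<in>I. q i * q j * (h i j + h j i))"
      using assms by blast
  qed
  finally show ?thesis
    by (simp add: assms(3) flip: sum_product)
qed

theorem theorem1:
  fixes M :: "'a measure"
    and n :: nat
    and v q :: "nat \<Rightarrow> real"
    and X Y p :: "'a \<Rightarrow> real"
    and SG :: "'a set"
  assumes "prob_space M"
    and "strict_mono_on {1..n} v"
    and "(\<Sum>i = 1..n. q i) = 1"
    and "\<exists>i\<in>{1..n}. \<exists>j\<in>{1..n}. i \<noteq> j \<and> q i > 0 \<and> q j > 0"
    and "\<And>i. i \<in> {1..n} \<Longrightarrow> \<P>(\<omega> in M. X \<omega> = v i) = q i"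
    and "\<And>i. i \<in> {1..n} \<Longrightarrow> \<P>(\<omega> in M. Y \<omega> = v i) = q i"
    and "\<And>U. open U \<Longrightarrow> U \<noteq> {} \<Longrightarrow> \<P>(\<omega> in M. p \<omega> \<in> U) > 0"
    and "prob_space.indep_vars M (\<lambda>_. borel) (\<lambda>i. [X, Y, p] ! i) {..<3}"
    and "SG \<in> sets M"
    and "\<And>\<omega>. \<omega> \<in> space M \<Longrightarrow> X \<omega> \<noteq> Y \<omega> \<Longrightarrow> p \<omega> < X \<omega> \<Longrightarrow>
           \<omega> \<in> SG \<longleftrightarrow> X \<omega> > Y \<omega>"
    and "\<And>\<omega>. \<omega> \<in> space M \<Longrightarrow> X \<omega> \<noteq> Y \<omega> \<Longrightarrow> p \<omega> > X \<omega> \<Longrightarrow>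
           \<omega> \<in> SG \<longleftrightarrow> Y \<omega> > X \<omega>"
    and "\<P>(\<omega> in M. \<omega> \<in> SG \<bar> X \<omega> = Y \<omega>) = 1 / 2"
  shows "measure M SG > 1 / 2"
proof -
  interpret prob_space M by fact
  note indep = assms(8) and SG = assms(9)
  have rv: "random_variable borel ([X, Y, p] ! i)" if "i < 3" for i
    using indep that unfolding indep_vars_def by auto
  have [measurable]: "random_variable borel X" "random_variable borel Y" "random_variable borel p"
    using rv[of 0] rv[of 1] rv[of 2] by simp_all
  have [measurable]: "SG \<in> events" by fact
  let ?I = "{1..n}"
  have v_less: "v i < v j \<longleftrightarrow> i < j" and v_eq: "v i = v j \<longleftrightarrow> i = j" if "i \<in> ?I" "j \<in> ?I" for i j
    using strict_mono_on_less[OF assms(2) that] strict_mono_on_eq[OF assms(2) that] by blast+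
  have q_nonneg: "q i \<ge> 0" if "i \<in> ?I" for i
    using assms(5)[OF that] by (metis measure_nonneg)
  have split: "\<P>(\<omega> in M. X \<omega> = v i \<and> Y \<omega> = v j \<and> p \<omega> \<in> U) = q i * q j * \<P>(\<omega> in M. p \<omega> \<in> U)"
    if "i \<in> ?I" "j \<in> ?I" "U \<in> sets borel" for i j U
    using indep_vars_three[OF indep, of "{v i}" "{v j}" U] assms(5,6) that by simp
  \<comment> \<open>Off the diagonal, \<open>h i j\<close> is the chance that the pointer lies
    strictly on the side of \<open>v i\<close> that makes the guess correct when
    \<open>X = v i\<close> and \<open>Y = v j\<close>. The value on the diagonal is the one
    prescribed for ties.\<close>
  define h where "h i j = (if i = j then 1 / 2
    else if i < j then \<P>(\<omega> in M. p \<omega> \<in> {v i<..}) else \<P>(\<omega> in M. p \<omega> \<in> {..<v i}))" for i j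
  have h_gt: "h i j + h j i > 1" if ij: "i \<in> ?I" "j \<in> ?I" "i < j" for i j
  proof -
    let ?A = "{\<omega> \<in> space M. p \<omega> \<in> {v i<..}}" and ?B = "{\<omega> \<in> space M. p \<omega> \<in> {..<v j}}"
    have lt: "v i < v j" using v_less ij by simp
    have "prob (?A \<union> ?B) = prob ?A + prob (?B - ?A)"
      by (rule finite_measure_Union') measurable
    also have "prob (?B - ?A) = prob ?B - prob (?B \<inter> ?A)"
      by (rule finite_measure_Diff') measurable
    also have "?A \<union> ?B = space M" using lt by auto
    also have "?B \<inter> ?A = {\<omega> \<in> space M. p \<omega> \<in> {v i<..<v j}}" by auto
    finally have "prob ?A + prob ?B = 1 + \<P>(\<omega> in M. p \<omega> \<in> {v i<..<v j})"
      by (simp add: prob_space)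
    moreover have "\<P>(\<omega> in M. p \<omega> \<in> {v i<..<v j}) > 0"
      using assms(7)[of "{v i<..<v j}"] lt by auto
    \<comment> \<open>Since \<open>i < j\<close>, \<open>h j i\<close> falls into the last branch of
      the definition and equals \<open>prob ?B\<close>.\<close>
    ultimately show ?thesis using ij by (simp add: h_def)
  qed
  have h_gt': "h i j + h j i > 1" if "i \<in> ?I" "j \<in> ?I" "i \<noteq> j" for i j
    using h_gt[of i j] h_gt[of j i] that by (simp add: add.commute neq_iff) argo
  have h_ge: "h i j + h j i \<ge> 1" if "i \<in> ?I" "j \<in> ?I" for i j
    using h_gt'[OF that] by (cases "i = j") (auto simp: h_def)

  define D where "D = {\<omega> \<in> space M. X \<omega> = Y \<omega>}"
  define E where "E i j = {\<omega> \<in> space M. X \<omega> = v i \<and> Y \<omega> = v j}" for i j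
  have [measurable]: "D \<in> events" "\<And>i j. E i j \<in> events"
    unfolding D_def E_def by measurable
  have E_disj: "E i j \<inter> E k l = {}" if "i \<in> ?I" "j \<in> ?I" "k \<in> ?I" "l \<in> ?I" "(i, j) \<noteq> (k, l)"
    for i j k l
    using that v_eq by (auto simp: E_def)
  \<comment> \<open>Only an inequality, because nothing is prescribed about success when
    \<open>p\<close> hits \<open>X\<close> exactly.\<close>
  have off: "q i * q j * h i j \<le> prob (SG \<inter> E i j)" if ij: "i \<in> ?I" "j \<in> ?I" "i \<noteq> j" for i j
  proof -
    define U where "U = (if i < j then {v i<..} else {..<v i})"
    have [measurable]: "U \<in> sets borel" by (simp add: U_def)
    have "q i * q j * h i j = \<P>(\<omega> in M. X \<omega> = v i \<and> Y \<omega> = v j \<and> p \<omega> \<in> U)"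
      using ij by (simp add: split h_def U_def)
    also have "\<dots> \<le> prob (SG \<inter> E i j)"
    proof (rule finite_measure_mono)
      show "{\<omega> \<in> space M. X \<omega> = v i \<and> Y \<omega> = v j \<and> p \<omega> \<in> U} \<subseteq> SG \<inter> E i j"
      proof safe
        fix \<omega> assume \<omega>: "\<omega> \<in> space M" "X \<omega> = v i" "Y \<omega> = v j" "p \<omega> \<in> U"
        have "v i \<noteq> v j" using v_eq ij by blast
        then show "\<omega> \<in> SG"
          using assms(10,11)[OF \<omega>(1)] v_less[OF ij(1,2)] \<omega>(2-4)
          by (cases "i < j") (simp_all add: U_def)
        show "\<omega> \<in> E i j" using \<omega> by (simp add: E_def)
      qed
    qed measurable
    finally show ?thesis .
  qed
  \<comment> \<open>On a null set \<open>X\<close> and \<open>Y\<close> may agree at a value outside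
    the list \<open>v\<close>; the inequality avoids treating it.\<close>
  have diag: "(\<Sum>i\<in>?I. q i * q i) \<le> prob D"
  proof -
    have "q i * q i = prob (E i i)" if "i \<in> ?I" for i
      \<comment> \<open>Taking the whole line as \<open>U\<close> drops the condition on the
        pointer.\<close>
      using split[of i i UNIV] that by (simp add: E_def prob_space)
    then have "(\<Sum>i\<in>?I. q i * q i) = (\<Sum>i\<in>?I. prob (E i i))" by simp
    also have "\<dots> = prob (\<Union>i\<in>?I. E i i)"
      using E_disj by (intro finite_measure_finite_Union[symmetric])
        (auto simp: disjoint_family_on_def)
    also have "\<dots> \<le> prob D"
      by (rule finite_measure_mono) (auto simp: E_def D_def)
    finally show ?thesis .
  qed
  have SG_D: "prob (SG \<inter> D) = prob D / 2"
  proof -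
    have "SG \<inter> D = {\<omega> \<in> space M. \<omega> \<in> SG \<and> X \<omega> = Y \<omega>}" by (auto simp: D_def)
    \<comment> \<open>Division by zero yields 0, so the value 1/2 forces \<open>prob D\<close> to be
      nonzero and the fraction can be cleared.\<close>
    then have "prob (SG \<inter> D) / prob D = 1 / 2"
      using assms(12) by (simp add: cond_prob_def D_def)
    then show ?thesis by (auto simp: field_simps)
  qed

  let ?P = "{(i, j) \<in> ?I \<times> ?I. i \<noteq> j}"
  have fin: "finite ?P" by (rule finite_subset[of _ "?I \<times> ?I"]) auto
  have "1 / 2 < (\<Sum>i\<in>?I. \<Sum>j\<in>?I. q i * q j * h i j)"
  proof -
    obtain a b where ab: "a \<in> ?I" "b \<in> ?I" "a \<noteq> b" "q a > 0" "q b > 0"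
      using assms(4) by blast
    show ?thesis
      by (rule double_sum_symmetrization_gt[OF _ q_nonneg assms(3) h_ge ab(1,2,4,5) h_gt'[OF ab(1-3)]])
        simp_all
  qed
  also have "\<dots> = (\<Sum>(i, j)\<in>?I \<times> ?I. q i * q j * h i j)"
    by (simp add: sum.cartesian_product)
  \<comment> \<open>The square of indices is cut into ties and distinct results: the former are
    estimated by \<open>diag\<close> and \<open>SG_D\<close>, the latter by
    \<open>off\<close>.\<close>
  also have "\<dots> = (\<Sum>(i, j)\<in>?P \<union> (\<lambda>i. (i, i)) ` ?I. q i * q j * h i j)"
    by (rule sum.cong) auto
  also have "\<dots> = (\<Sum>(i, j)\<in>?P. q i * q j * h i j) + (\<Sum>i\<in>?I. q i * q i) / 2"
    using fin by (subst sum.union_disjoint)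
      (auto simp: sum.reindex inj_on_def h_def sum_divide_distrib)
  also have "\<dots> \<le> (\<Sum>(i, j)\<in>?P. prob (SG \<inter> E i j)) + prob (SG \<inter> D)"
    using diag SG_D off by (intro add_mono sum_mono) auto
  also have "(\<Sum>(i, j)\<in>?P. prob (SG \<inter> E i j)) = prob (\<Union>(i, j)\<in>?P. SG \<inter> E i j)"
  proof -
    have "disjoint_family_on (\<lambda>(i, j). SG \<inter> E i j) ?P"
      unfolding disjoint_family_on_def using E_disj by blast
    then have "prob (\<Union>x\<in>?P. (\<lambda>(i, j). SG \<inter> E i j) x)
        = (\<Sum>x\<in>?P. prob ((\<lambda>(i, j). SG \<inter> E i j) x))"
      using fin by (intro finite_measure_finite_Union) auto
    then show ?thesis by (simp add: case_prod_unfold)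
  qed
  \<comment> \<open>The off-diagonal \<open>E i j\<close> miss \<open>D\<close> because
    \<open>v\<close> is injective on the index range.\<close>
  also have "\<dots> + prob (SG \<inter> D) = prob ((\<Union>(i, j)\<in>?P. SG \<inter> E i j) \<union> (SG \<inter> D))"
    using fin v_eq by (intro finite_measure_Union[symmetric] sets.finite_UN)
      (auto simp: E_def D_def)
  also have "\<dots> \<le> prob SG"
    by (rule finite_measure_mono) auto
  finally show ?thesis .
qed

end
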